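(* Let $\mathcal{X}\subseteq\mathbb{R}^n\times\mathbb{R}^{m\times n}\times\mathbb{R}^m$ be a domain of LP problems. Suppose $\mathcal{X}$ is weakly solution-wise bounded for the primal and the solution correspondence $S$ is upper semicontinuous on $\mathcal{X}$. If $\xi\in\mathcal{X}$ is singleton-solvable, then $S$ is lower semicontinuous at $\xi$.
   Context: Let $m,n$ be positive integers. An $m\times n$ LP problem is a triple $\xi=(p,A,b)\in\mathbb{R}^n\times\mathbb{R}^{m\times n}\times\mathbb{R}^m$, standing for: maximize $p^Tx$ subject to $Ax=b$, $x\ge 0$ (coordinatewise). Its feasible set is $X(\xi)=\{x\in\mathbb{R}^n_+ : Ax=b\}$ and its set of optimal solutions is $S(\xi)=\{x\in X(\xi): p^Tx\ge p^Tx' \text{ for all } x'\in X(\xi)\}$. A domain is a non-empty subset $\mathcal{X}$ of $\mathbb{R}^n\times\mathbb{R}^{m\times n}\times\mathbb{R}^m$ such that $S(\xi)\neq\emptyset$ for every $\xi\in\mathcal{X}$. The solution correspondence on $\mathcal{X}$ is the set-valued map $\xi\mapsto S(\xi)$ from $\mathcal{X}$ to subsets of $\mathbb{R}^n_+$. Convergence of LP problems means convergence of each component $p$, $A$, $b$ in Euclidean norm. $\mathcal{X}$ is weakly solution-wise bounded for the primal if there is a non-empty bounded subset $\Omega$ of $\mathbb{R}^n$ such that $\Omega\cap S(\xi)\neq\emptyset$ for all $\xi\in\mathcal{X}$. An LP problem $\xi$ is singleton-solvable if $S(\xi)$ is a singleton. For a correspondence (set-valued map) $F:\mathcal{X}\to\to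 Y$, $Y$ a subset of a Euclidean space, and $\xi\in\mathcal{X}$: $F$ is upper semicontinuous at $\xi$ if for all sequences $\xi(N)\to\xi$ in $\mathcal{X}$ and $y(N)\to y$ in $Y$ with limit $y\in Y$, $y(N)\in F(\xi(N))$ for all $N\in\mathbb{N}$ implies $y\in F(\xi)$. $F$ is upper semicontinuous on $\mathcal{X}$ if it is so at every $\xi\in\mathcal{X}$. $F$ is lower semicontinuous at $\xi$ if for every sequence $\xi(N)\to\xi$ in $\mathcal{X}$ and every $y\in F(\xi)$ there is a sequence $y(N)\to y$ in $Y$ with $y(N)\in F(\xi(N))$ for all $N\in\mathbb{N}$. *)

theory Defs
  imports "HOL-Analysis.Analysis"
begin

text \<open>
  The numbers of variables and constraints are \<open>CARD('n)\<close> and \<open>CARD('m)\<close>, both automatically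
  positive.  Convergence in the product type is convergence of each of the three components in
  its Euclidean norm (the norm of \<open>real ^ 'n ^ 'm\<close> is the Frobenius norm).
\<close>

type_synonym ('n, 'm) lp = "(real ^ 'n) \<times> (real ^ 'n ^ 'm) \<times> (real ^ 'm)"

definition nonneg_orthant :: "(real ^ 'n) set" where
  "nonneg_orthant = {x. \<forall>i. 0 \<le> x $ i}"

definition lp_feasible :: "('n::finite, 'm::finite) lp \<Rightarrow> (real ^ 'n) set" where
  "lp_feasible = (\<lambda>(p, A, b). {x \<in> nonneg_orthant. A *v x = b})"

definition lp_solutions :: "('n::finite, 'm::finite) lp \<Rightarrow> (real ^ 'n) set" where
  "lp_solutions = (\<lambda>(p, A, b).
     {x \<in> lp_feasible (p, A, b). \<forall>x' \<in> lp_feasible (p, A, b). p \<bullet> x' \<le> p \<bullet> x})"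

definition lp_domain :: "('n::finite, 'm::finite) lp set \<Rightarrow> bool" where
  "lp_domain \<X> \<longleftrightarrow> \<X> \<noteq> {} \<and> (\<forall>\<xi> \<in> \<X>. lp_solutions \<xi> \<noteq> {})"

definition weakly_solution_bounded_primal :: "('n::finite, 'm::finite) lp set \<Rightarrow> bool" where
  "weakly_solution_bounded_primal \<X> \<longleftrightarrow>
     (\<exists>\<Omega>. \<Omega> \<noteq> {} \<and> bounded \<Omega> \<and> (\<forall>\<xi> \<in> \<X>. \<Omega> \<inter> lp_solutions \<xi> \<noteq> {}))"

definition singleton_solvable :: "('n::finite, 'm::finite) lp \<Rightarrow> bool" where
  "singleton_solvable \<xi> \<longleftrightarrow> is_singleton (lp_solutions \<xi>)"

text \<open>
  Sequential semicontinuity at \<open>\<xi>\<close> of a correspondence \<open>F\<close> from \<open>\<X>\<close> to subsets of \<open>Y\<close>.  Only the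
  values of \<open>F\<close> on \<open>\<X>\<close> matter.  The upper notion is the closed-graph one and does not by itself
  exclude values escaping to infinity.
\<close>

definition upper_semicontinuous_at ::
    "'a::topological_space set \<Rightarrow> 'b::topological_space set \<Rightarrow> ('a \<Rightarrow> 'b set) \<Rightarrow> 'a \<Rightarrow> bool" where
  "upper_semicontinuous_at \<X> Y F \<xi> \<longleftrightarrow>
     (\<forall>\<xi>s ys y. (\<forall>N::nat. \<xi>s N \<in> \<X>) \<and> \<xi>s \<longlonglongrightarrow> \<xi> \<and>
        (\<forall>N. ys N \<in> Y) \<and> y \<in> Y \<and> ys \<longlonglongrightarrow> y \<and> (\<forall>N. ys N \<in> F (\<xi>s N)) \<longrightarrow> y \<in> F \<xi>)"

definition upper_semicontinuous_on ::
    "'a::topological_space set \<Rightarrow> 'b::topological_space set \<Rightarrow> ('a \<Rightarrow> 'b set) \<Rightarrow> bool" where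
  "upper_semicontinuous_on \<X> Y F \<longleftrightarrow> (\<forall>\<xi> \<in> \<X>. upper_semicontinuous_at \<X> Y F \<xi>)"

definition lower_semicontinuous_at ::
    "'a::topological_space set \<Rightarrow> 'b::topological_space set \<Rightarrow> ('a \<Rightarrow> 'b set) \<Rightarrow> 'a \<Rightarrow> bool" where
  "lower_semicontinuous_at \<X> Y F \<xi> \<longleftrightarrow>
     (\<forall>\<xi>s y. (\<forall>N::nat. \<xi>s N \<in> \<X>) \<and> \<xi>s \<longlonglongrightarrow> \<xi> \<and> y \<in> F \<xi> \<longrightarrow>
        (\<exists>ys. (\<forall>N. ys N \<in> Y) \<and> ys \<longlonglongrightarrow> y \<and> (\<forall>N. ys N \<in> F (\<xi>s N))))"

end

theory Submission
  imports Defs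
begin

text \<open>
  Choose optimal solutions from the bounded set. By upper semicontinuity every cluster point of the
  chosen sequence solves \<open>\<xi>\<close>, hence is its unique solution; a bounded sequence with a single
  cluster point converges to it.
\<close>

text \<open>If convergence fails, the terms at distance at least some \<open>e > 0\<close> from
  \<open>l\<close> form a bounded subsequence. By compactness it has a convergent further
  subsequence, whose limit cannot be \<open>l\<close>.\<close>

lemma bounded_unique_cluster_point_LIMSEQ:
  fixes X :: "nat \<Rightarrow> 'a::heine_borel"
  assumes bdd: "bounded (range X)"
    and unique: "\<And>r l'. strict_mono r \<Longrightarrow> (X \<circ> r) \<longlonglongrightarrow> l' \<Longrightarrow> l' = l"
  shows "X \<longlonglongrightarrow> l"
proof (rule ccontr)
  assume "\<not> X \<longlonglongrightarrow> l"
  then obtain e where "e > 0" and "\<exists>\<^sub>F n in sequentially. \<not> dist (X n) l < e"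
    unfolding tendsto_iff not_eventually[symmetric] by auto
  \<comment> \<open>Along \<open>sequentially\<close>, holding frequently means holding at
    infinitely many indices; these can be listed increasingly.\<close>
  then have "infinite {n. \<not> dist (X n) l < e}"
    by (simp add: frequently_cofinite cofinite_eq_sequentially[symmetric])
  then obtain r :: "nat \<Rightarrow> nat" where r: "strict_mono r" "\<And>n. \<not> dist (X (r n)) l < e"
    using infinite_enumerate by blast
  have "bounded (range (X \<circ> r))"
    using bdd by (rule bounded_subset) auto
  then obtain l' s where s: "strict_mono s" "((X \<circ> r) \<circ> s) \<longlonglongrightarrow> l'"
    using bounded_imp_convergent_subsequence by blast
  then have "l' = l"
    using unique[of "r \<circ> s" l'] r(1) by (simp add: strict_mono_o comp_assoc)
  then have "\<forall>\<^sub>F n in sequentially. dist (X (r (s n))) l < e"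
    using tendstoD[OF s(2) \<open>e > 0\<close>] by simp
  then show False
    using r(2) by simp
qed

lemma closed_nonneg_orthant: "closed nonneg_orthant"
  unfolding nonneg_orthant_def
  by (intro closed_Collect_all closed_Collect_le continuous_intros)

lemma lp_solutions_subset_nonneg_orthant: "lp_solutions \<xi> \<subseteq> nonneg_orthant"
  by (auto simp: lp_solutions_def lp_feasible_def split: prod.splits)

theorem proposition9:
  fixes \<X> :: "('n::finite, 'm::finite) lp set" and \<xi> :: "('n, 'm) lp"
  assumes "lp_domain \<X>"
    and "weakly_solution_bounded_primal \<X>"
    and "upper_semicontinuous_on \<X> nonneg_orthant lp_solutions"
    and "\<xi> \<in> \<X>"
    and "singleton_solvable \<xi>"
  shows "lower_semicontinuous_at \<X> nonneg_orthant lp_solutions \<xi>"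
  unfolding lower_semicontinuous_at_def
proof (intro allI impI, elim conjE)
  fix \<xi>s :: "nat \<Rightarrow> ('n, 'm) lp" and y
  assume in_dom: "\<forall>N. \<xi>s N \<in> \<X>" and conv: "\<xi>s \<longlonglongrightarrow> \<xi>" and "y \<in> lp_solutions \<xi>"
  then have single: "lp_solutions \<xi> = {y}"
    using assms(5) by (auto simp: singleton_solvable_def is_singleton_def)
  \<comment> \<open>One \<open>\<Omega>\<close> serves all of \<open>\<X>\<close>, so the selection
    \<open>ys\<close> is bounded uniformly in \<open>N\<close>; a closed graph alone would not
    prevent escape to infinity.\<close>
  obtain \<Omega> where "bounded \<Omega>" and meets: "\<forall>\<xi>\<in>\<X>. \<Omega> \<inter> lp_solutions \<xi> \<noteq> {}"
    using assms(2) by (auto simp: weakly_solution_bounded_primal_def)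
  have "\<forall>N. \<exists>x. x \<in> \<Omega> \<inter> lp_solutions (\<xi>s N)"
    using meets in_dom by blast
  then obtain ys where ys: "\<And>N. ys N \<in> \<Omega>" "\<And>N. ys N \<in> lp_solutions (\<xi>s N)"
    by (metis IntE)
  have nonneg: "ys N \<in> nonneg_orthant" for N
    using ys(2) lp_solutions_subset_nonneg_orthant by blast
  have "ys \<longlonglongrightarrow> y"
  proof (rule bounded_unique_cluster_point_LIMSEQ)
    show "bounded (range ys)"
      using \<open>bounded \<Omega>\<close> by (rule bounded_subset) (use ys(1) in auto)
  next
    fix r l
    assume r: "strict_mono r" and l: "(ys \<circ> r) \<longlonglongrightarrow> l"
    \<comment> \<open>Upper semicontinuity only concerns limits inside the target set; closedness of
      the orthant puts \<open>l\<close> there.\<close>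
    have "l \<in> nonneg_orthant"
      using closed_sequentially[OF closed_nonneg_orthant _ l] nonneg by simp
    \<comment> \<open>The problems are reindexed by the same \<open>r\<close> as the solutions, so
      that \<open>ys (r N)\<close> still solves \<open>\<xi>s (r N)\<close>.\<close>
    moreover have "(\<xi>s \<circ> r) \<longlonglongrightarrow> \<xi>"
      using conv r by (rule LIMSEQ_subseq_LIMSEQ)
    moreover have "upper_semicontinuous_at \<X> nonneg_orthant lp_solutions \<xi>"
      using assms(3,4) by (simp add: upper_semicontinuous_on_def)
    ultimately have "l \<in> lp_solutions \<xi>"
      unfolding upper_semicontinuous_at_def
      using l in_dom nonneg ys(2) by (elim allE[of _ "\<xi>s \<circ> r"] allE[of _ "ys \<circ> r"]) auto
    then show "l = y"
      using single by simp
  qed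
  then show "\<exists>ys. (\<forall>N. ys N \<in> nonneg_orthant) \<and> ys \<longlonglongrightarrow> y \<and> (\<forall>N. ys N \<in> lp_solutions (\<xi>s N))"
    using nonneg ys(2) by blast
qed

end
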